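(* Let $\mathcal{U}$ be a finite set of size $n$ and let $1\le s\le n$. (1) For every $t$ and every $m$ there exists an average-case $(\mathsf{SDif}_s(\mathcal{U}),\,m,\,m-\log\binom{n}{s}+\log A(n,2t+1,s),\,t)$-secure sketch, i.e. one with entropy loss $\log\binom ns-\log A(n,2t+1,s)$. (2) If $t$ is even, then every $(\mathsf{SDif}_s(\mathcal{U}),\,m,\,m',\,t)$-secure sketch with $m=\log\binom ns$ (uniform inputs) has entropy loss $m-m'\ge\log\binom ns-\log A(n,2t+1,s)$.
   Context: Logarithms are base 2. $\mathsf{SDif}_s(\mathcal{U})$ is the set of all $s$-element subsets of $\mathcal{U}$ with distance $\mathsf{dis}(w,w')=|w\triangle w'|$. $A(n,d,s)$ is the maximum number of codewords in a code in $\{0,1\}^n$ all of whose words have exactly $s$ ones and whose distinct words have pairwise Hamming distance at least $d$. Min-entropy: $\mathbf{H}_\infty(A)=-\log\max_a\Pr[A=a]$. Average min-entropy: $\tilde{\mathbf{H}}_\infty(A\mid B)=-\log\big(\mathbb{E}_{b\leftarrow B}[\max_a\Pr[A=a\mid B=b]]\big)$. An $(\mathcal{M},m,\tilde m,t)$-secure sketch is a pair of randomized procedures: $\mathsf{SS}$ maps $w\in\mathcal{M}$ to a bit string; $\mathsf{Rec}$ takes $w'\in\mathcal{M}$ and a bit string; correctness: if $\mathsf{dis}(w,w')\le t$ then $\mathsf{Rec}(w',\mathsf{SS}(w))=w$; security: for every distribution $W$ on $\mathcal{M}$ with min-entropy at least $m$, $\tilde{\mathbf{H}}_\infty(W\mid\mathsf{SS}(W))\ge\tilde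 m$. It is average-case if, more strongly, for any random variables $W$ over $\mathcal{M}$ and $I$ over $\{0,1\}^*$ with $\tilde{\mathbf{H}}_\infty(W\mid I)\ge m$ we have $\tilde{\mathbf{H}}_\infty(W\mid(\mathsf{SS}(W),I))\ge\tilde m$. The entropy loss is $m-\tilde m$. *)

theory Defs
  imports "HOL-Probability.Probability"
begin

definition min_entropy :: "'a pmf \<Rightarrow> real" where
  "min_entropy A = - log 2 (SUP a. pmf A a)"

text \<open>The argument is the joint distribution of the pair \<open>(A, B)\<close>. The suprema here and in
  \<open>min_entropy\<close> are attained, since a discrete distribution is summable.\<close>

definition avg_min_entropy :: "('a \<times> 'b) pmf \<Rightarrow> real" where
  "avg_min_entropy P =
     - log 2 (measure_pmf.expectation (map_pmf snd P)
         (\<lambda>b. SUP a. \<P>(x in measure_pmf P. fst x = a \<bar> snd x = b)))"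

type_synonym 'w sketch_proc = "'w \<Rightarrow> bool list pmf"
type_synonym 'w recover_proc = "'w \<Rightarrow> bool list \<Rightarrow> 'w pmf"

text \<open>Recovery is required to succeed with probability 1 over the coins of both procedures.\<close>

definition sketch_correct ::
  "'w set \<Rightarrow> ('w \<Rightarrow> 'w \<Rightarrow> nat) \<Rightarrow> nat \<Rightarrow> 'w sketch_proc \<Rightarrow> 'w recover_proc \<Rightarrow> bool" where
  "sketch_correct M dis t SS Rec \<longleftrightarrow>
     (\<forall>w\<in>M. \<forall>w'\<in>M. dis w w' \<le> t \<longrightarrow> bind_pmf (SS w) (Rec w') = return_pmf w)"

definition secure_sketch ::
  "'w set \<Rightarrow> ('w \<Rightarrow> 'w \<Rightarrow> nat) \<Rightarrow> real \<Rightarrow> real \<Rightarrow> nat \<Rightarrow> 'w sketch_proc \<Rightarrow> 'w recover_proc \<Rightarrow> bool"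
where
  "secure_sketch M dis m m' t SS Rec \<longleftrightarrow>
     sketch_correct M dis t SS Rec \<and>
     (\<forall>W. set_pmf W \<subseteq> M \<longrightarrow> min_entropy W \<ge> m \<longrightarrow>
        avg_min_entropy (bind_pmf W (\<lambda>w. map_pmf (\<lambda>z. (w, z)) (SS w))) \<ge> m')"

text \<open>\<open>J\<close> is the joint distribution of \<open>(W, I)\<close>; the coins of the sketching procedure are
  independent of \<open>(W, I)\<close>.\<close>

definition average_case_secure_sketch ::
  "'w set \<Rightarrow> ('w \<Rightarrow> 'w \<Rightarrow> nat) \<Rightarrow> real \<Rightarrow> real \<Rightarrow> nat \<Rightarrow> 'w sketch_proc \<Rightarrow> 'w recover_proc \<Rightarrow> bool"
where
  "average_case_secure_sketch M dis m m' t SS Rec \<longleftrightarrow>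
     secure_sketch M dis m m' t SS Rec \<and>
     (\<forall>J :: ('w \<times> bool list) pmf. fst ` set_pmf J \<subseteq> M \<longrightarrow> avg_min_entropy J \<ge> m \<longrightarrow>
        avg_min_entropy
          (bind_pmf J (\<lambda>(w, i). map_pmf (\<lambda>z. (w, (z, i))) (SS w))) \<ge> m')"

definition entropy_loss :: "real \<Rightarrow> real \<Rightarrow> real" where
  "entropy_loss m m' = m - m'"

definition SDif :: "nat \<Rightarrow> 'a set \<Rightarrow> 'a set set" where
  "SDif s U = {w. w \<subseteq> U \<and> card w = s}"

definition set_dis :: "'a set \<Rightarrow> 'a set \<Rightarrow> nat" where
  "set_dis w w' = card (sym_diff w w')"

definition hamming_dist :: "bool list \<Rightarrow> bool list \<Rightarrow> nat" where
  "hamming_dist x y = card {i. i < length x \<and> x ! i \<noteq> y ! i}"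

definition constant_weight_code :: "nat \<Rightarrow> nat \<Rightarrow> nat \<Rightarrow> bool list set \<Rightarrow> bool" where
  "constant_weight_code n d s C \<longleftrightarrow>
     (\<forall>x\<in>C. length x = n \<and> count_list x True = s) \<and>
     (\<forall>x\<in>C. \<forall>y\<in>C. x \<noteq> y \<longrightarrow> hamming_dist x y \<ge> d)"

definition max_code_size :: "nat \<Rightarrow> nat \<Rightarrow> nat \<Rightarrow> nat" where
  "max_code_size n d s = Max {card C | C. constant_weight_code n d s C}"

end

theory Submission
  imports Defs
begin

text \<open>Both halves rest on the fact that average min-entropy is the negated logarithm of the guessing
  probability \<open>\<Sum>b. max\<^sub>a Pr[A = a, B = b]\<close>.

  For (1), let \<open>C\<close> be an optimal code and let the sketch of \<open>w\<close> be a uniformly random permutation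
  \<open>p\<close> of the universe with \<open>p(w) \<in> C\<close>. As the symmetric group is transitive on \<open>s\<close>-subsets, a
  fraction \<open>|C| / \<close>\<open>(n choose s)\<close> of all permutations qualifies, independently of \<open>w\<close>; summing over
  all permutations, the guessing probability grows at most by the inverse of that fraction.

  For (2), all inputs \<open>w\<close> which are compatible with the same sketch value form a code of distance
  more than \<open>2t\<close>: two \<open>s\<close>-subsets at distance at most \<open>2t\<close> would have an \<open>s\<close>-subset within
  distance \<open>t\<close> of both (here \<open>t\<close> is even), from which recovery could not tell them apart. So the
  sketch leaves at most \<open>A(n, 2t + 1, s)\<close> candidates and the best guess has at least the
  inverse of this as its success probability.\<close>

section \<open>Average min-entropy through guessing probabilities\<close>

text \<open>The argument of the logarithm in \<open>avg_min_entropy\<close>, kept literally so that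
  the link is mere unfolding. Its other form, the sum over \<open>b\<close> of the largest joint
  probability, enters through the two inequalities \<open>guessing_prob_le\<close> and
  \<open>nn_integral_SUP_pmf_le_guessing_prob\<close>.\<close>

definition guessing_prob :: "('a \<times> 'b) pmf \<Rightarrow> real" where
  "guessing_prob P = measure_pmf.expectation (map_pmf snd P)
     (\<lambda>b. SUP a. \<P>(x in measure_pmf P. fst x = a \<bar> snd x = b))"

lemma avg_min_entropy_guessing_prob: "avg_min_entropy P = - log 2 (guessing_prob P)"
  by (simp add: avg_min_entropy_def guessing_prob_def)

lemma pmf_le_pmf_snd: "pmf P (a, b) \<le> pmf (map_pmf snd P) b"
proof -
  have "measure (measure_pmf P) {(a, b)} \<le> measure (measure_pmf P) (snd -` {b})"
    by (intro measure_pmf.finite_measure_mono) auto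
  then show ?thesis
    by (simp add: pmf_map measure_pmf_single)
qed

lemma bdd_above_pmf_pair: "bdd_above (range (\<lambda>a. pmf P (a, b)))"
  by (rule bdd_aboveI2[where M = 1]) (simp add: pmf_le_1)

lemma SUP_pmf_nonneg: "0 \<le> (SUP a. pmf P (a, b))"
  by (rule cSUP_upper2[OF bdd_above_pmf_pair UNIV_I pmf_nonneg])

text \<open>This covers values \<open>b\<close> of probability 0 as well: both sides are then 0, as
  division by 0 yields 0. Later integrals can therefore run over the whole type.\<close>

lemma cond_prob_fst_snd_pmf:
  "\<P>(x in measure_pmf P. fst x = a \<bar> snd x = b) = pmf P (a, b) / pmf (map_pmf snd P) b"
proof -
  have "{x. fst x = a \<and> snd x = b} = {(a, b)}"
    by auto
  then show ?thesis
    by (simp add: cond_prob_def pmf_map measure_pmf_single vimage_def)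
qed

lemma cond_prob_fst_snd_pmf_le_1:
  "\<P>(x in measure_pmf P. fst x = a \<bar> snd x = b) \<le> 1"
  unfolding cond_prob_fst_snd_pmf
  using pmf_le_pmf_snd[of P a b] pmf_nonneg[of "map_pmf snd P" b]
  by (simp add: divide_le_eq_1 less_le)

lemma SUP_cond_prob_bounds:
  fixes P :: "('a \<times> 'b) pmf"
  defines "g \<equiv> (\<lambda>b. SUP a. \<P>(x in measure_pmf P. fst x = a \<bar> snd x = b))"
  shows "0 \<le> g b" and "g b \<le> 1" and "\<P>(x in measure_pmf P. fst x = a \<bar> snd x = b) \<le> g b"
proof -
  show ge: "\<P>(x in measure_pmf P. fst x = a \<bar> snd x = b) \<le> g b" for a
    unfolding g_def
    by (rule cSUP_upper) (auto intro!: bdd_aboveI2[where M = 1] cond_prob_fst_snd_pmf_le_1)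
  show "g b \<le> 1"
    unfolding g_def by (rule cSUP_least) (auto intro: cond_prob_fst_snd_pmf_le_1)
  show "0 \<le> g b"
    by (rule order_trans[OF _ ge]) (simp add: cond_prob_fst_snd_pmf)
qed

text \<open>The conditional suprema lie between 0 and 1, so the expectation is integrable. Passing
  to a nonnegative integral over the counting measure spares summability arguments for an arbitrary
  type of \<open>b\<close>.\<close>

lemma ennreal_guessing_prob:
  "ennreal (guessing_prob P) =
     (\<integral>\<^sup>+ b. ennreal (pmf (map_pmf snd P) b *
        (SUP a. \<P>(x in measure_pmf P. fst x = a \<bar> snd x = b))) \<partial>count_space UNIV)"
  unfolding guessing_prob_def
  by (subst nn_integral_eq_integral[symmetric])
     (auto intro!: measure_pmf.integrable_const_bound[where B = 1] nn_integral_cong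
       simp: SUP_cond_prob_bounds nn_integral_measure_pmf ennreal_mult)

text \<open>Dividing the bound on the joint probabilities by the marginal bounds every conditional
  probability; multiplying back by the marginal leaves \<open>f b\<close>, which is then summed over
  \<open>b\<close>.\<close>

lemma guessing_prob_le:
  assumes "\<And>a b. pmf P (a, b) \<le> f b"
    and "(\<integral>\<^sup>+ b. ennreal (f b) \<partial>count_space UNIV) \<le> ennreal r" and "0 \<le> r"
  shows "guessing_prob P \<le> r"
proof -
  have "pmf (map_pmf snd P) b * (SUP a. \<P>(x in measure_pmf P. fst x = a \<bar> snd x = b)) \<le> f b"
    for b
  \<comment> \<open>At a value of probability 0 the left side vanishes, and \<open>f b\<close> is
    nonnegative because it dominates a probability.\<close>
  proof (cases "pmf (map_pmf snd P) b = 0")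
    case True
    then show ?thesis
      using order_trans[OF pmf_nonneg assms(1)] by simp
  next
    case False
    then have pos: "pmf (map_pmf snd P) b > 0"
      using pmf_nonneg[of "map_pmf snd P" b] by linarith
    have "(SUP a. \<P>(x in measure_pmf P. fst x = a \<bar> snd x = b)) \<le> f b / pmf (map_pmf snd P) b"
      using pos by (intro cSUP_least) (auto simp: cond_prob_fst_snd_pmf divide_right_mono assms(1))
    then show ?thesis
      using pos by (simp add: field_simps)
  qed
  then have "ennreal (guessing_prob P) \<le> (\<integral>\<^sup>+ b. ennreal (f b) \<partial>count_space UNIV)"
    unfolding ennreal_guessing_prob by (intro nn_integral_mono ennreal_leI)
  then show ?thesis
    using assms(2,3) by (metis ennreal_le_iff order_trans)
qed

lemma nn_integral_SUP_pmf_le_guessing_prob: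
  "(\<integral>\<^sup>+ b. ennreal (SUP a. pmf P (a, b)) \<partial>count_space UNIV) \<le> ennreal (guessing_prob P)"
  unfolding ennreal_guessing_prob
proof (intro nn_integral_mono ennreal_leI cSUP_least)
  fix a b
  let ?g = "SUP a. \<P>(x in measure_pmf P. fst x = a \<bar> snd x = b)"
  have "pmf P (a, b) = pmf (map_pmf snd P) b * \<P>(x in measure_pmf P. fst x = a \<bar> snd x = b)"
    using pmf_le_pmf_snd[of P a b] pmf_nonneg[of P "(a, b)"]
    by (cases "pmf (map_pmf snd P) b = 0") (auto simp: cond_prob_fst_snd_pmf)
  also have "\<dots> \<le> pmf (map_pmf snd P) b * ?g"
    by (intro mult_left_mono SUP_cond_prob_bounds) simp
  finally show "pmf P (a, b) \<le> pmf (map_pmf snd P) b * ?g" .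
qed simp_all

lemma guessing_prob_nonneg: "0 \<le> guessing_prob P"
  unfolding guessing_prob_def by (intro integral_nonneg_AE AE_I2 SUP_cond_prob_bounds)

text \<open>A single atom of \<open>P\<close> already contributes a positive amount. Comparing and
  splitting logarithms of guessing probabilities relies on this.\<close>

lemma guessing_prob_pos: "0 < guessing_prob P"
proof -
  obtain a b where ab: "(a, b) \<in> set_pmf P"
    by (metis ex_in_conv set_pmf_not_empty surj_pair)
  have "0 < ennreal (pmf P (a, b))"
    using ab by (simp add: pmf_positive)
  also have "\<dots> \<le> ennreal (SUP a. pmf P (a, b))"
    by (intro ennreal_leI cSUP_upper bdd_above_pmf_pair) simp
  also have "\<dots> \<le> (\<integral>\<^sup>+ b. ennreal (SUP a. pmf P (a, b)) \<partial>count_space UNIV)"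
    by (rule nn_integral_ge_point) simp
  also have "\<dots> \<le> ennreal (guessing_prob P)"
    by (rule nn_integral_SUP_pmf_le_guessing_prob)
  finally show ?thesis by simp
qed

text \<open>With at most \<open>K\<close> candidates for each \<open>b\<close>, the marginal at
  \<open>b\<close> is at most \<open>K\<close> times the largest joint probability; the marginals
  sum to 1. Finiteness is a separate hypothesis because \<open>card\<close> of an infinite set is
  0.\<close>

lemma guessing_prob_ge_inverse_card:
  assumes "\<And>b. finite {a. (a, b) \<in> set_pmf P}" and "\<And>b. card {a. (a, b) \<in> set_pmf P} \<le> K"
  shows "1 \<le> real K * guessing_prob P"
proof -
  have "pmf (map_pmf snd P) b \<le> real K * (SUP a. pmf P (a, b))" for b
  proof -
    let ?A = "{a. (a, b) \<in> set_pmf P}"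
    have nonneg: "0 \<le> (SUP a. pmf P (a, b))"
      by (rule SUP_pmf_nonneg)
    have "pmf (map_pmf snd P) b = measure (measure_pmf P) ((\<lambda>a. (a, b)) ` ?A)"
      unfolding pmf_map by (rule measure_prob_cong_0) (auto simp: set_pmf_iff)
    also have "\<dots> = (\<Sum>a\<in>?A. pmf P (a, b))"
      using assms(1) by (subst measure_measure_pmf_finite) (auto simp: sum.reindex inj_on_def)
    also have "\<dots> \<le> real (card ?A) * (SUP a. pmf P (a, b))"
      by (intro sum_bounded_above cSUP_upper bdd_above_pmf_pair) simp
    also have "\<dots> \<le> real K * (SUP a. pmf P (a, b))"
      using assms(2) nonneg by (intro mult_right_mono) auto
    finally show ?thesis .
  qed
  then have "(\<integral>\<^sup>+ b. ennreal (pmf (map_pmf snd P) b) \<partial>count_space UNIV)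
      \<le> (\<integral>\<^sup>+ b. ennreal (real K * (SUP a. pmf P (a, b))) \<partial>count_space UNIV)"
    by (intro nn_integral_mono ennreal_leI)
  also have "\<dots> = real K * (\<integral>\<^sup>+ b. ennreal (SUP a. pmf P (a, b)) \<partial>count_space UNIV)"
    by (subst nn_integral_cmult[symmetric]) (auto simp: ennreal_mult')
  also have "\<dots> \<le> real K * ennreal (guessing_prob P)"
    by (intro mult_left_mono nn_integral_SUP_pmf_le_guessing_prob) simp
  also have "\<dots> = ennreal (real K * guessing_prob P)"
    by (simp add: ennreal_mult')
  finally have "1 \<le> ennreal (real K * guessing_prob P)"
    by (simp add: nn_integral_pmf_eq_1)
  then show ?thesis by (metis ennreal_1 ennreal_le_iff2 not_one_le_zero)
qed

section \<open>Entropy loss of sketches with pointwise bounded output\<close>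

lemma pmf_bind_map_Pair:
  "pmf (bind_pmf W (\<lambda>w. map_pmf (\<lambda>z. (w, z)) (S w))) (w, z) = pmf W w * pmf (S w) z"
proof -
  have "pmf (map_pmf (\<lambda>z. (v, z)) (S v)) (w, z) = pmf (S w) z * indicator {w} v" for v
    by (cases "v = w")
       (auto simp: pmf_map_inj' inj_on_def pmf_eq_0_set_pmf)
  then show ?thesis
    by (simp add: pmf_bind measure_pmf_single)
qed

lemma pmf_bind_map_Pair_side_information:
  "pmf (bind_pmf J (\<lambda>(w, i). map_pmf (\<lambda>z. (w, (z, i))) (S w))) (w, (z, i))
     = pmf J (w, i) * pmf (S w) z"
proof -
  have "pmf ((\<lambda>(w, i). map_pmf (\<lambda>z. (w, (z, i))) (S w)) v) (w, (z, i))
      = pmf (S w) z * indicator {(w, i)} v" for v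
  proof (cases "v = (w, i)")
    case True
    then show ?thesis
      using pmf_map_inj'[of "\<lambda>z. (w, (z, i))" "S w" z] by (simp add: inj_on_def)
  next
    case False
    then show ?thesis
      by (cases v) (auto simp: pmf_eq_0_set_pmf)
  qed
  then show ?thesis
    by (simp add: pmf_bind measure_pmf_single)
qed

text \<open>The bound on the sketch distribution does not depend on \<open>w\<close>, so it factors
  out of the maximum over \<open>w\<close>; summing it over \<open>Z\<close> multiplies the guessing
  probability by at most \<open>c * card Z\<close>. The same works separately for each value of the
  side information.\<close>

lemma average_case_secure_sketchI:
  fixes S :: "'w sketch_proc"
  assumes "sketch_correct M dis t S R" and "finite Z" and "Z \<noteq> {}" and "0 < c"
    and pmf_le: "\<And>w z. w \<in> M \<Longrightarrow> pmf (S w) z \<le> c * indicator Z z"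
  shows "average_case_secure_sketch M dis m (m - log 2 (c * card Z)) t S R"
proof -
  have L: "0 < c * card Z"
    using assms by (simp add: card_gt_0_iff)
  \<comment> \<open>Here \<open>x\<close> stands for the guessing probability before the sketch is
    seen and \<open>y\<close> for the one after it.\<close>
  have ent: "m - log 2 (c * card Z) \<le> - log 2 y"
    if "m \<le> - log 2 x" "0 < y" "0 < x" "y \<le> c * card Z * x" for x y
  proof -
    have "log 2 y \<le> log 2 (c * card Z * x)"
      using that L by simp
    also have "\<dots> = log 2 (c * card Z) + log 2 x"
      using that L by (subst log_mult) auto
    finally show ?thesis using that by simp
  qed
  have Z_int: "(\<integral>\<^sup>+ z. ennreal (c * indicator Z z * p) \<partial>count_space UNIV)
      = ennreal (c * card Z * p)" if "0 \<le> p" for p :: real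
  proof -
    have "(\<integral>\<^sup>+ z. ennreal (c * indicator Z z * p) \<partial>count_space UNIV)
        = (\<integral>\<^sup>+ z. ennreal (c * p) * indicator Z z \<partial>count_space UNIV)"
      by (intro nn_integral_cong) (auto simp: indicator_def)
    also have "\<dots> = ennreal (c * p) * of_nat (card Z)"
      using assms by (simp add: nn_integral_cmult_indicator emeasure_count_space)
    also have "\<dots> = ennreal (c * card Z * p)"
      using assms that
      by (simp add: ennreal_of_nat_eq_real_of_nat ennreal_mult[symmetric] mult_ac)
    finally show ?thesis .
  qed
  have "m - log 2 (c * card Z) \<le> avg_min_entropy (bind_pmf W (\<lambda>w. map_pmf (\<lambda>z. (w, z)) (S w)))"
    if W: "set_pmf W \<subseteq> M" and m: "m \<le> min_entropy W" for W
  proof -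
    let ?p = "SUP w. pmf W w"
    have bdd: "bdd_above (range (pmf W))"
      by (rule bdd_aboveI2[where M = 1]) (simp add: pmf_le_1)
    obtain w0 where "w0 \<in> set_pmf W"
      using set_pmf_not_empty by fast
    then have p: "0 < ?p"
      by (rule less_le_trans[OF pmf_positive cSUP_upper[OF UNIV_I bdd]])
    have "guessing_prob (bind_pmf W (\<lambda>w. map_pmf (\<lambda>z. (w, z)) (S w))) \<le> c * card Z * ?p"
    proof (rule guessing_prob_le[where f = "\<lambda>z. c * indicator Z z * ?p"])
      fix w z
      show "pmf (bind_pmf W (\<lambda>w. map_pmf (\<lambda>z. (w, z)) (S w))) (w, z) \<le> c * indicator Z z * ?p"
      proof (cases "w \<in> M")
        case True
        have "pmf W w * pmf (S w) z \<le> ?p * (c * indicator Z z)"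
          using p by (intro mult_mono pmf_le True cSUP_upper bdd) auto
        then show ?thesis by (simp add: pmf_bind_map_Pair mult_ac)
      next
        \<comment> \<open>Outside \<open>M\<close> nothing is known about \<open>S w\<close>, but
          such \<open>w\<close> have probability 0 under \<open>W\<close>.\<close>
        case False
        then have "pmf W w = 0"
          using W by (auto simp: pmf_eq_0_set_pmf)
        then show ?thesis using p assms(4) by (simp add: pmf_bind_map_Pair)
      qed
    qed (use p L Z_int in auto)
    then show ?thesis
      unfolding avg_min_entropy_guessing_prob
      by (rule ent[OF m[unfolded min_entropy_def] guessing_prob_pos p])
  qed
  moreover have "m - log 2 (c * card Z)
      \<le> avg_min_entropy (bind_pmf J (\<lambda>(w, i). map_pmf (\<lambda>z. (w, (z, i))) (S w)))"
    if J: "fst ` set_pmf J \<subseteq> M" and m: "m \<le> avg_min_entropy J" for J :: "('w \<times> bool list) pmf"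
  proof -
    let ?p = "\<lambda>i. SUP w. pmf J (w, i)"
    have p: "0 \<le> ?p i" for i
      by (rule SUP_pmf_nonneg)
    have "guessing_prob (bind_pmf J (\<lambda>(w, i). map_pmf (\<lambda>z. (w, (z, i))) (S w)))
        \<le> c * card Z * guessing_prob J"
    \<comment> \<open>The maximum over \<open>w\<close> is now taken for each \<open>i\<close>.
      Integrating over \<open>z\<close> first gives the constant factor, and what remains is the
      integral over \<open>i\<close> bounded by \<open>guessing_prob J\<close>.\<close>
    proof (rule guessing_prob_le[where f = "\<lambda>(z, i). c * indicator Z z * ?p i"])
      fix w and zi :: "bool list \<times> bool list"
      obtain z i where zi: "zi = (z, i)" by fastforce
      show "pmf (bind_pmf J (\<lambda>(w, i). map_pmf (\<lambda>z. (w, (z, i))) (S w))) (w, zi)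
          \<le> (case zi of (z, i) \<Rightarrow> c * indicator Z z * ?p i)"
      proof (cases "w \<in> M")
        case True
        have "pmf J (w, i) * pmf (S w) z \<le> ?p i * (c * indicator Z z)"
          using p[of i] by (intro mult_mono pmf_le True cSUP_upper bdd_above_pmf_pair) auto
        then show ?thesis by (simp add: zi pmf_bind_map_Pair_side_information mult_ac)
      next
        case False
        then have "pmf J (w, i) = 0"
          using J by (force simp: pmf_eq_0_set_pmf)
        then show ?thesis
          using p[of i] assms(4) by (simp add: zi pmf_bind_map_Pair_side_information)
      qed
    next
      have "(\<integral>\<^sup>+ zi. ennreal (case zi of (z, i) \<Rightarrow> c * indicator Z z * ?p i) \<partial>count_space UNIV)
          = (\<integral>\<^sup>+ i. \<integral>\<^sup>+ z. ennreal (c * indicator Z z * ?p i) \<partial>count_space UNIV \<partial>count_space UNIV)"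
        by (subst nn_integral_snd_count_space[symmetric]) simp
      also have "\<dots> = (\<integral>\<^sup>+ i. ennreal (c * card Z) * ennreal (?p i) \<partial>count_space UNIV)"
        using p L by (simp add: Z_int ennreal_mult')
      also have "\<dots> = ennreal (c * card Z) * (\<integral>\<^sup>+ i. ennreal (?p i) \<partial>count_space UNIV)"
        by (rule nn_integral_cmult) simp
      also have "\<dots> \<le> ennreal (c * card Z) * ennreal (guessing_prob J)"
        by (intro mult_left_mono nn_integral_SUP_pmf_le_guessing_prob) simp
      also have "\<dots> = ennreal (c * card Z * guessing_prob J)"
        using L by (simp add: ennreal_mult' guessing_prob_nonneg)
      finally show "(\<integral>\<^sup>+ zi. ennreal (case zi of (z, i) \<Rightarrow> c * indicator Z z * ?p i)
          \<partial>count_space UNIV) \<le> ennreal (c * card Z * guessing_prob J)" .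
    qed (intro mult_nonneg_nonneg less_imp_le[OF L] guessing_prob_nonneg)
    then show ?thesis
      unfolding avg_min_entropy_guessing_prob
      by (rule ent[OF m[unfolded avg_min_entropy_guessing_prob] guessing_prob_pos guessing_prob_pos])
  qed
  ultimately show ?thesis
    using assms(1) unfolding average_case_secure_sketch_def secure_sketch_def by blast
qed

section \<open>Sketches from transitive families of isometries\<close>

text \<open>The number \<open>N b\<close> of maps taking \<open>w\<close> to \<open>b\<close> is the
  same for all \<open>b\<close> in \<open>M\<close>: composing with a map that moves
  \<open>b\<close> to \<open>b'\<close> is injective, and this applies in both directions. Hence
  \<open>C\<close> receives \<open>card C * N w\<close> maps and \<open>M\<close> receives all of
  \<open>G\<close>.\<close>

lemma card_transitive_maps:
  assumes "finite G" and "finite M" and "C \<subseteq> M" and "w \<in> M"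
    and inj: "\<And>g. g \<in> G \<Longrightarrow> inj g" and closed: "\<And>g. g \<in> G \<Longrightarrow> g ` M \<subseteq> M"
    and comp: "\<And>g h. g \<in> G \<Longrightarrow> h \<in> G \<Longrightarrow> h \<circ> g \<in> G"
    and trans: "\<And>x y. x \<in> M \<Longrightarrow> y \<in> M \<Longrightarrow> \<exists>g\<in>G. g x = y"
  shows "card M * card {g \<in> G. g w \<in> C} = card C * card G"
proof -
  define N where "N b = card {g \<in> G. g w = b}" for b
  have le: "N b \<le> N b'" if b: "b \<in> M" "b' \<in> M" for b b'
  proof -
    obtain h where h: "h \<in> G" "h b = b'"
      using trans[OF b] by blast
    show ?thesis
      unfolding N_def
    proof (rule card_inj_on_le)
      show "inj_on (\<lambda>g. h \<circ> g) {g \<in> G. g w = b}"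
        using inj[OF h(1)] by (simp add: inj_on_def fun.inj_map_strong fun_eq_iff inj_def)
      show "(\<lambda>g. h \<circ> g) ` {g \<in> G. g w = b} \<subseteq> {g \<in> G. g w = b'}"
        using h comp by auto
    qed (use assms in auto)
  qed
  have sum: "card {g \<in> G. g w \<in> D} = card D * N w" if "D \<subseteq> M" for D
  proof -
    have fin: "finite D"
      using that assms(2) finite_subset by blast
    have "{g \<in> G. g w \<in> D} = (\<Union>b\<in>D. {g \<in> G. g w = b})"
      by auto
    then have "card {g \<in> G. g w \<in> D} = (\<Sum>b\<in>D. N b)"
      using fin assms(1) unfolding N_def by (simp only:) (rule card_UN_disjoint; auto)
    also have "\<dots> = (\<Sum>b\<in>D. N w)"
      using that assms(4) by (intro sum.cong refl antisym le) auto
    finally show ?thesis by simp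
  qed
  have "{g \<in> G. g w \<in> M} = G"
    using closed assms(4) by auto
  then have "card G = card M * N w"
    using sum[of M] by simp
  then show ?thesis
    using sum[OF assms(3)] by simp
qed

text \<open>The construction for (1), freed from permutations. Recovery is unique decoding in the
  code pulled back along the published map. The triangle inequality measures both distances to
  \<open>z\<close>, so it carries the symmetry that decoding uses.\<close>

lemma transitive_isometries_sketch:
  fixes dis :: "'w \<Rightarrow> 'w \<Rightarrow> nat"
  assumes "finite G" and "finite M" and "C \<subseteq> M" and "C \<noteq> {}"
    and inj: "\<And>g. g \<in> G \<Longrightarrow> inj g" and closed: "\<And>g. g \<in> G \<Longrightarrow> g ` M \<subseteq> M"
    and comp: "\<And>g h. g \<in> G \<Longrightarrow> h \<in> G \<Longrightarrow> h \<circ> g \<in> G"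
    and trans: "\<And>x y. x \<in> M \<Longrightarrow> y \<in> M \<Longrightarrow> \<exists>g\<in>G. g x = y"
    and isometry: "\<And>g x y. g \<in> G \<Longrightarrow> dis (g x) (g y) = dis x y"
    and triangle: "\<And>x y z. x \<in> M \<Longrightarrow> y \<in> M \<Longrightarrow> z \<in> M \<Longrightarrow> dis x y \<le> dis x z + dis y z"
    and code: "\<And>x y. x \<in> C \<Longrightarrow> y \<in> C \<Longrightarrow> x \<noteq> y \<Longrightarrow> 2 * t + 1 \<le> dis x y"
  shows "\<exists>S R. average_case_secure_sketch M dis m (m - log 2 (card M) + log 2 (card C)) t S R"
proof -
  \<comment> \<open>Sketch values must be bit strings, so the maps in \<open>G\<close> are named by
    arbitrary distinct strings.\<close>
  obtain Z :: "bool list set" where Z: "finite Z" "card Z = card G"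
    using infinite_arbitrarily_large[OF infinite_UNIV_listI, of "card G"] by metis
  then obtain enc where enc: "bij_betw enc G Z"
    using assms(1) by (metis finite_same_card_bij)
  define S where "S w = map_pmf enc (pmf_of_set {g \<in> G. g w \<in> C})" for w
  define dec where "dec = the_inv_into G enc"
  define R where "R w' z = return_pmf (THE w. w \<in> M \<and> dec z w \<in> C \<and> dis w w' \<le> t)" for w' z
  have dec_enc: "dec (enc g) = g" if "g \<in> G" for g
    using that enc by (simp add: dec_def bij_betw_def the_inv_into_f_f)
  have cards: "card M > 0" "card C > 0"
    using assms by (auto simp: card_gt_0_iff finite_subset)
  have nonempty: "{g \<in> G. g w \<in> C} \<noteq> {}" if "w \<in> M" for w
    using trans[OF that] assms(3,4) by blast
  have "G \<noteq> {}"
    using nonempty assms(3,4) by blast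
  then have "card G > 0"
    using assms(1) by (simp add: card_gt_0_iff)
  have "sketch_correct M dis t S R"
    unfolding sketch_correct_def
  proof (intro ballI impI)
    fix w w' assume w: "w \<in> M" "w' \<in> M" "dis w w' \<le> t"
    have "R w' z = return_pmf w" if z: "z \<in> set_pmf (S w)" for z
    proof -
      obtain g where g: "g \<in> G" "g w \<in> C" "z = enc g"
        using z set_pmf_of_set[OF nonempty[OF w(1)]] assms(1) by (auto simp: S_def)
      \<comment> \<open>Two candidates near \<open>w'\<close> are within \<open>2 * t\<close> of
        each other, and so are their images under the isometry \<open>g\<close>; these are distinct
        codewords by injectivity, against the minimum distance.\<close>
      have unique: "v = w" if v: "v \<in> M" "g v \<in> C" "dis v w' \<le> t" for v
      proof (rule ccontr)
        assume "v \<noteq> w"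
        then have "2 * t + 1 \<le> dis (g v) (g w)"
          using g v by (intro code) (auto dest: injD[OF inj])
        also have "\<dots> = dis v w"
          using g by (simp add: isometry)
        also have "\<dots> \<le> 2 * t"
          using triangle[OF v(1) w(1,2)] v w by simp
        finally show False by simp
      qed
      have "dec z = g"
        using g by (simp add: dec_enc)
      then have "(THE v. v \<in> M \<and> dec z v \<in> C \<and> dis v w' \<le> t) = w"
        using w g by (intro the_equality) (simp, metis unique)
      then show ?thesis by (simp add: R_def)
    qed
    then have "bind_pmf (S w) (R w') = bind_pmf (S w) (\<lambda>_. return_pmf w)"
      by (intro bind_pmf_cong) auto
    then show "bind_pmf (S w) (R w') = return_pmf w" by simp
  qed
  \<comment> \<open>The constant is the inverse of the number of maps sending \<open>w\<close> into
    \<open>C\<close>, by \<open>card_transitive_maps\<close> the same for every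
    \<open>w\<close>.\<close>
  moreover have "pmf (S w) z \<le> (card M / (card C * card G)) * indicator Z z" if w: "w \<in> M" for w z
  proof (cases "z \<in> Z")
    case False
    then have "z \<notin> set_pmf (S w)"
      using nonempty[OF w] assms(1) enc by (auto simp: S_def bij_betw_def)
    then show ?thesis using False by (simp add: pmf_eq_0_set_pmf)
  next
    case True
    then obtain g where g: "g \<in> G" "z = enc g"
      using enc by (auto simp: bij_betw_def)
    let ?A = "{g \<in> G. g w \<in> C}"
    have "card M * card ?A = card C * card G"
      using assms(1-3) w inj closed comp trans by (rule card_transitive_maps)
    then have card_A: "real (card M) * real (card ?A) = real (card C) * real (card G)"
      by (simp flip: of_nat_mult)
    \<comment> \<open>Only an inclusion: \<open>g\<close> need not send \<open>w\<close> into
      \<open>C\<close>, in which case the left side is empty.\<close>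
    have "enc -` {z} \<inter> set_pmf (pmf_of_set ?A) \<subseteq> {g}"
      using nonempty[OF w] assms(1) g enc by (auto simp: bij_betw_def inj_on_def)
    then have "measure (measure_pmf (pmf_of_set ?A)) (enc -` {z})
        \<le> measure (measure_pmf (pmf_of_set ?A)) {g}"
      by (subst measure_Int_set_pmf[symmetric]) (intro measure_pmf.finite_measure_mono; simp)
    then have "pmf (S w) z \<le> pmf (pmf_of_set ?A) g"
      by (simp add: S_def pmf_map measure_pmf_single)
    also have "\<dots> \<le> 1 / card ?A"
      using nonempty[OF w] assms(1) by (simp add: indicator_def)
    also have "\<dots> = card M / (card C * card G)"
    proof -
      have "card ?A > 0"
        using nonempty[OF w] assms(1) by (simp add: card_gt_0_iff)
      then show ?thesis
        using card_A cards \<open>card G > 0\<close> by (simp add: field_simps)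
    qed
    finally show ?thesis using True by simp
  qed
  moreover have "Z \<noteq> {}"
    using Z \<open>card G > 0\<close> by auto
  ultimately have "average_case_secure_sketch M dis m
      (m - log 2 (card M / (card C * card G) * card Z)) t S R"
    using Z cards \<open>card G > 0\<close> by (intro average_case_secure_sketchI) auto
  \<comment> \<open>The size of \<open>G\<close> cancels since \<open>Z\<close> has as many
    elements.\<close>
  also have "card M / (card C * card G) * card Z = card M / card C"
    using Z \<open>card G > 0\<close> by simp
  also have "log 2 (card M / card C) = log 2 (card M) - log 2 (card C)"
    using cards by (simp add: log_divide)
  finally show ?thesis by (auto simp: algebra_simps)
qed

section \<open>Geometry of the subsets of fixed size\<close>

lemma finite_SDif: "finite U \<Longrightarrow> finite (SDif s U)"
  unfolding SDif_def by (rule finite_subset[of _ "Pow U"]) auto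

lemma card_SDif: "finite U \<Longrightarrow> card (SDif s U) = card U choose s"
  unfolding SDif_def by (rule n_subsets)

lemma set_dis_triangle:
  assumes "finite x" and "finite y" and "finite z"
  shows "set_dis x y \<le> set_dis x z + set_dis y z"
proof -
  have "card (sym_diff x y) \<le> card (sym_diff x z \<union> sym_diff y z)"
    using assms by (intro card_mono) auto
  then show ?thesis
    unfolding set_dis_def using card_Un_le order_trans by blast
qed

lemma set_dis_image:
  assumes "inj f"
  shows "set_dis (f ` x) (f ` y) = set_dis x y"
proof -
  have "sym_diff (f ` x) (f ` y) = f ` sym_diff x y"
    using assms by (auto simp: inj_def)
  then show ?thesis
    using assms by (simp add: set_dis_def card_image inj_on_subset)
qed

lemma permutes_image_SDif:
  assumes "p permutes U" and "w \<in> SDif s U"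
  shows "p ` w \<in> SDif s U"
  using assms permutes_image[OF assms(1)] permutes_inj_on[OF assms(1), of w]
  by (auto simp: SDif_def card_image)

text \<open>A bijection from \<open>x\<close> to \<open>y\<close> is glued to one between the
  complements in \<open>U\<close>, which have equal size, and to the identity outside
  \<open>U\<close>.\<close>

lemma permutes_transitive_SDif:
  assumes "finite U" and "x \<in> SDif s U" and "y \<in> SDif s U"
  shows "\<exists>p. p permutes U \<and> p ` x = y"
proof -
  have fin: "finite x" "finite y" and sub: "x \<subseteq> U" "y \<subseteq> U"
    using assms by (auto simp: SDif_def intro: finite_subset)
  obtain f where f: "bij_betw f x y"
    using fin assms finite_same_card_bij[of x y] by (auto simp: SDif_def)
  have "card (U - x) = card (U - y)"
    using assms fin sub by (simp add: SDif_def card_Diff_subset)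
  then obtain g where g: "bij_betw g (U - x) (U - y)"
    using assms(1) by (metis finite_Diff finite_same_card_bij)
  define p where "p u = (if u \<in> x then f u else if u \<in> U then g u else u)" for u
  have px: "bij_betw p x y"
    using f by (simp add: p_def cong: bij_betw_cong)
  have "bij_betw p (U - x) (U - y)"
    using g by (rule iffD1[OF bij_betw_cong, rotated]) (simp add: p_def)
  then have "bij_betw p (x \<union> (U - x)) (y \<union> (U - y))"
    using px by (intro bij_betw_combine) auto
  then have "bij_betw p U U"
    using sub by (simp add: Un_absorb1)
  then have "p permutes U"
    using sub by (intro bij_imp_permutes) (auto simp: p_def)
  then show ?thesis
    using px by (auto simp: bij_betw_def)
qed

text \<open>Exchanging \<open>j\<close> elements of \<open>x - y\<close> for \<open>j\<close>
  elements of \<open>y - x\<close> gives a set at distance \<open>2 * j\<close> from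
  \<open>x\<close> and \<open>2 * (k - j)\<close> from \<open>y\<close>. All distances between sets
  of equal size are even, which is why the parity of \<open>t\<close> matters.\<close>

lemma SDif_even_midpoint:
  assumes "finite U" and "x \<in> SDif s U" and "y \<in> SDif s U"
    and "set_dis x y \<le> 2 * t" and "even t"
  shows "\<exists>z\<in>SDif s U. set_dis x z \<le> t \<and> set_dis y z \<le> t"
proof -
  have fin: "finite x" "finite y" and sub: "x \<subseteq> U" "y \<subseteq> U" and cs: "card x = s" "card y = s"
    using assms by (auto simp: SDif_def intro: finite_subset)
  define k where "k = card (x - y)"
  have k: "card (x - y) = k" "card (y - x) = k"
    using fin cs card_Int_Diff[of x y] card_Int_Diff[of y x] by (auto simp: k_def Int_commute)
  have "set_dis x y = 2 * k"
    unfolding set_dis_def using fin k by (subst card_Un_disjoint) auto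
  then have "k \<le> t" using assms(4) by simp
  \<comment> \<open>For even \<open>t\<close> the division is exact, so \<open>k <= t\<close> leaves
    at most \<open>t div 2\<close> exchanges for the way to \<open>y\<close>.\<close>
  define j where "j = min k (t div 2)"
  have j: "j \<le> k" "2 * j \<le> t" "2 * (k - j) \<le> t"
    using \<open>k \<le> t\<close> \<open>even t\<close> by (auto simp: j_def elim!: evenE)
  obtain a where a: "a \<subseteq> x - y" "card a = j"
    using obtain_subset_with_card_n[of j "x - y"] k j by metis
  obtain b where b: "b \<subseteq> y - x" "card b = j"
    using obtain_subset_with_card_n[of j "y - x"] k j by metis
  have fab: "finite a" "finite b"
    using a b fin finite_subset by blast+
  define z where "z = (x - a) \<union> b"
  have cz: "card z = s"
  proof -
    have "a \<subseteq> x" using a by auto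
    then have "j \<le> card x" using a fin card_mono by metis
    moreover have "card z = card (x - a) + card b"
      unfolding z_def using fin fab b by (intro card_Un_disjoint) auto
    ultimately show ?thesis
      using a b cs fab \<open>a \<subseteq> x\<close> by (simp add: card_Diff_subset)
  qed
  have "sym_diff x z = a \<union> b"
    using a b by (auto simp: z_def)
  then have "set_dis x z \<le> t"
    using card_Un_le[of a b] a b j by (simp add: set_dis_def)
  moreover have "sym_diff y z = (y - x - b) \<union> (x - y - a)"
    using a b by (auto simp: z_def)
  then have "set_dis y z \<le> t"
    using card_Un_le[of "y - x - b" "x - y - a"] a b j k fab
    by (simp add: set_dis_def card_Diff_subset)
  moreover have "z \<in> SDif s U"
    using cz a b sub by (auto simp: SDif_def z_def)
  ultimately show ?thesis by blast
qed

section \<open>Constant-weight codes as families of subsets\<close>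

context
  fixes U :: "'a set" and n s :: nat and e :: "nat \<Rightarrow> 'a"
  assumes e: "bij_betw e {..<n} U"
begin

definition char_word :: "'a set \<Rightarrow> bool list" where
  "char_word w = map (\<lambda>i. e i \<in> w) [0..<n]"

lemma card_index_set:
  assumes "w \<subseteq> U"
  shows "card {i. i < n \<and> e i \<in> w} = card w"
proof -
  have "bij_betw e {i. i < n \<and> e i \<in> w} w"
    using e assms by (auto simp: bij_betw_def inj_on_def)
  then show ?thesis by (rule bij_betw_same_card)
qed

lemma count_list_char_word:
  assumes "w \<subseteq> U"
  shows "count_list (char_word w) True = card w"
proof -
  have "count_list (char_word w) True = length (filter (\<lambda>i. e i \<in> w) [0..<n])"
    by (simp add: char_word_def count_list_eq_length_filter filter_map o_def)
  also have "\<dots> = card {i. i < n \<and> e i \<in> w}"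
    by (simp add: length_filter_conv_card cong: conj_cong)
  finally show ?thesis
    using card_index_set[OF assms] by simp
qed

lemma hamming_dist_char_word:
  assumes "w \<subseteq> U" and "w' \<subseteq> U"
  shows "hamming_dist (char_word w) (char_word w') = set_dis w w'"
proof -
  have "{i. i < length (char_word w) \<and> char_word w ! i \<noteq> char_word w' ! i}
      = {i. i < n \<and> e i \<in> sym_diff w w'}"
    by (auto simp: char_word_def)
  then show ?thesis
    using assms card_index_set[of "sym_diff w w'"] by (auto simp: hamming_dist_def set_dis_def)
qed

lemma bij_betw_char_word:
  "bij_betw char_word (SDif s U) {x. length x = n \<and> count_list x True = s}"
  unfolding bij_betw_def
proof (intro conjI equalityI subsetI)
  show "inj_on char_word (SDif s U)"
  proof (rule inj_onI)
    fix v w assume vw: "v \<in> SDif s U" "w \<in> SDif s U" "char_word v = char_word w"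
    then have "e i \<in> v \<longleftrightarrow> e i \<in> w" if "i < n" for i
      using that by (simp add: char_word_def)
    moreover have "v \<subseteq> e ` {..<n}" "w \<subseteq> e ` {..<n}"
      using vw e by (auto simp: SDif_def bij_betw_def)
    ultimately show "v = w" by blast
  qed
next
  fix x assume "x \<in> char_word ` SDif s U"
  then show "x \<in> {x. length x = n \<and> count_list x True = s}"
    using count_list_char_word by (auto simp: SDif_def) (simp add: char_word_def)
next
  fix x :: "bool list" assume x: "x \<in> {x. length x = n \<and> count_list x True = s}"
  define w where "w = e ` {i. i < n \<and> x ! i}"
  have w: "w \<subseteq> U"
    using e by (auto simp: w_def bij_betw_def)
  have "x = char_word w"
    using x e by (intro nth_equalityI) (auto simp: char_word_def w_def bij_betw_def inj_on_def)
  moreover from this have "w \<in> SDif s U"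
    using x w count_list_char_word[OF w] by (simp add: SDif_def)
  ultimately show "x \<in> char_word ` SDif s U" by blast
qed

lemma constant_weight_code_char_word:
  assumes "C \<subseteq> SDif s U"
  shows "constant_weight_code n d s (char_word ` C) \<longleftrightarrow>
    (\<forall>x\<in>C. \<forall>y\<in>C. x \<noteq> y \<longrightarrow> d \<le> set_dis x y)"
proof -
  have "char_word x = char_word y \<longleftrightarrow> x = y" if "x \<in> C" "y \<in> C" for x y
    using bij_betw_char_word assms that by (auto simp: bij_betw_def inj_on_def)
  moreover have "hamming_dist (char_word x) (char_word y) = set_dis x y" if "x \<in> C" "y \<in> C" for x y
    using assms that by (intro hamming_dist_char_word) (auto simp: SDif_def)
  moreover have "length (char_word x) = n \<and> count_list (char_word x) True = s" if "x \<in> C" for x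
    using bij_betw_char_word assms that by (auto simp: bij_betw_def)
  ultimately show ?thesis
    by (simp add: constant_weight_code_def)
qed

end

text \<open>The characteristic words along an enumeration of \<open>U\<close> give a
  distance-preserving bijection onto the words of weight \<open>s\<close>, so codes on both sides
  have the same sizes and \<open>max_code_size\<close> can be computed inside
  \<open>SDif s U\<close>.\<close>

lemma SDif_codes:
  assumes "finite U" and "card U = n"
  shows "{card C | C. constant_weight_code n d s C} =
    {card C | C. C \<subseteq> SDif s U \<and> (\<forall>x\<in>C. \<forall>y\<in>C. x \<noteq> y \<longrightarrow> d \<le> set_dis x y)}"
proof -
  obtain e where e: "bij_betw e {..<n} U"
    using assms by (metis finite_same_card_bij finite_lessThan card_lessThan)
  note bij = bij_betw_char_word[OF e, of s]
  have card: "card (char_word n e ` C) = card C" if "C \<subseteq> SDif s U" for C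
    using bij that by (meson bij_betw_def card_image inj_on_subset)
  note code = constant_weight_code_char_word[OF e, of _ s d]
  show ?thesis
  proof (intro equalityI subsetI)
    fix k assume "k \<in> {card C | C. constant_weight_code n d s C}"
    then obtain C where C: "constant_weight_code n d s C" "k = card C"
      by blast
    then have "C \<subseteq> char_word n e ` SDif s U"
      unfolding bij_betw_imp_surj_on[OF bij] by (auto simp: constant_weight_code_def)
    then obtain D where "D \<subseteq> SDif s U" "C = char_word n e ` D"
      by (rule subset_imageE)
    then show "k \<in> {card C | C. C \<subseteq> SDif s U
        \<and> (\<forall>x\<in>C. \<forall>y\<in>C. x \<noteq> y \<longrightarrow> d \<le> set_dis x y)}"
      using C card[of D] code[of D] by (intro CollectI exI[of _ D]) auto
  next
    fix k assume "k \<in> {card C | C. C \<subseteq> SDif s U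
        \<and> (\<forall>x\<in>C. \<forall>y\<in>C. x \<noteq> y \<longrightarrow> d \<le> set_dis x y)}"
    then obtain D where D: "D \<subseteq> SDif s U" "k = card D"
      and "\<forall>x\<in>D. \<forall>y\<in>D. x \<noteq> y \<longrightarrow> d \<le> set_dis x y"
      unfolding mem_Collect_eq by (elim exE conjE)
    then have "constant_weight_code n d s (char_word n e ` D)"
      by (simp add: code)
    then show "k \<in> {card C | C. constant_weight_code n d s C}"
      using D card[of D] by (intro CollectI exI[of _ "char_word n e ` D"]) simp
  qed
qed

lemma finite_SDif_code_cards:
  assumes "finite U"
  shows "finite {card C | C. C \<subseteq> SDif s U \<and> (\<forall>x\<in>C. \<forall>y\<in>C. x \<noteq> y \<longrightarrow> d \<le> set_dis x y)}"
  by (rule finite_subset[of _ "card ` Pow (SDif s U)"]) (auto simp: finite_SDif assms)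

lemma card_le_max_code_size:
  assumes "finite U" and "card U = n" and "C \<subseteq> SDif s U"
    and "\<And>x y. x \<in> C \<Longrightarrow> y \<in> C \<Longrightarrow> x \<noteq> y \<Longrightarrow> d \<le> set_dis x y"
  shows "card C \<le> max_code_size n d s"
  unfolding max_code_size_def SDif_codes[OF assms(1,2)]
  using assms by (intro Max_ge finite_SDif_code_cards) auto

lemma max_code_size_attained:
  assumes "finite U" and "card U = n"
  obtains C where "C \<subseteq> SDif s U" and "\<And>x y. x \<in> C \<Longrightarrow> y \<in> C \<Longrightarrow> x \<noteq> y \<Longrightarrow> d \<le> set_dis x y"
    and "card C = max_code_size n d s"
proof -
  let ?A = "{card C | C. C \<subseteq> SDif s U \<and> (\<forall>x\<in>C. \<forall>y\<in>C. x \<noteq> y \<longrightarrow> d \<le> set_dis x y)}"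
  have "max_code_size n d s \<in> ?A"
    unfolding max_code_size_def SDif_codes[OF assms]
    \<comment> \<open>The maximum is over a nonempty set because the empty family is a code.\<close>
    by (intro Max_in finite_SDif_code_cards assms(1)) blast
  then show ?thesis
    using that by auto
qed

text \<open>One single word is a code for every distance, and \<open>s <= n\<close> provides a word
  of weight \<open>s\<close>.\<close>

lemma max_code_size_pos:
  assumes "s \<le> n"
  shows "0 < max_code_size n d s"
proof -
  have "{..<s} \<in> SDif s {..<n}"
    using assms by (auto simp: SDif_def)
  then show ?thesis
    using card_le_max_code_size[of "{..<n}" n "{{..<s}}" s d] by auto
qed

section \<open>The lower bound on the entropy loss\<close>

lemma sketch_value_candidates_far_apart:
  assumes "finite U" and "even t" and correct: "sketch_correct (SDif s U) set_dis t S R"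
    and xy: "x \<in> SDif s U" "y \<in> SDif s U" "x \<noteq> y"
    and z: "z \<in> set_pmf (S x)" "z \<in> set_pmf (S y)"
  shows "2 * t + 1 \<le> set_dis x y"
proof (rule ccontr)
  assume "\<not> ?thesis"
  then obtain w where w: "w \<in> SDif s U" "set_dis x w \<le> t" "set_dis y w \<le> t"
    using SDif_even_midpoint[OF assms(1) xy(1,2) _ assms(2)] by (auto simp: not_le)
  \<comment> \<open>Correctness speaks of the mixture over all sketch values, but the support of a
    mixture contains the support of every component, so recovery is certain for each possible
    \<open>z\<close>.\<close>
  have "set_pmf (R w z) \<subseteq> {v}" if "v \<in> SDif s U" "set_dis v w \<le> t" "z \<in> set_pmf (S v)" for v
  proof -
    have "set_pmf (bind_pmf (S v) (R w)) = {v}"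
      using correct that w(1) by (auto simp: sketch_correct_def)
    then show ?thesis using that by auto
  qed
  then have "set_pmf (R w z) \<subseteq> {x} \<inter> {y}"
    using xy z w by blast
  then show False
    using xy(3) set_pmf_not_empty[of "R w z"] by auto
qed

lemma min_entropy_pmf_of_set:
  assumes "finite A" and "A \<noteq> {}"
  shows "min_entropy (pmf_of_set A) = log 2 (card A)"
proof -
  have "(SUP a. pmf (pmf_of_set A) a) = 1 / card A"
  proof (rule antisym)
    show "(SUP a. pmf (pmf_of_set A) a) \<le> 1 / card A"
      using assms by (intro cSUP_least) (auto simp: indicator_def)
    obtain a where "a \<in> A" using assms by blast
    then show "1 / card A \<le> (SUP a. pmf (pmf_of_set A) a)"
      using assms
      by (intro cSUP_upper2[where x = a] bdd_aboveI2[where M = 1] pmf_le_1) auto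
  qed
  then show ?thesis
    using assms by (simp add: min_entropy_def log_divide card_gt_0_iff)
qed

text \<open>The uniform distribution has exactly the min-entropy that the security hypothesis
  demands. Given a sketch value, the inputs still possible form a code, so
  \<open>guessing_prob_ge_inverse_card\<close> applies with the maximal code size.\<close>

lemma SDif_secure_sketch_bound:
  assumes "finite U" and "card U = n" and "s \<le> n" and "even t"
    and sketch: "secure_sketch (SDif s U) set_dis (log 2 (n choose s)) m' t S R"
  shows "m' \<le> log 2 (max_code_size n (2 * t + 1) s)"
proof -
  let ?M = "SDif s U" and ?K = "max_code_size n (2 * t + 1) s"
  have M: "finite ?M" "card ?M = n choose s"
    using assms by (auto simp: finite_SDif card_SDif)
  then have "?M \<noteq> {}"
    using assms(3) by (metis card.empty binomial_eq_0_iff not_le)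
  let ?W = "pmf_of_set ?M"
  let ?P = "bind_pmf ?W (\<lambda>w. map_pmf (\<lambda>z. (w, z)) (S w))"
  have supp: "{w. (w, z) \<in> set_pmf ?P} = {w \<in> ?M. z \<in> set_pmf (S w)}" for z
    using M \<open>?M \<noteq> {}\<close> by auto
  have "m' \<le> avg_min_entropy ?P"
    using sketch M \<open>?M \<noteq> {}\<close> by (auto simp: secure_sketch_def min_entropy_pmf_of_set)
  also have "\<dots> = - log 2 (guessing_prob ?P)"
    by (rule avg_min_entropy_guessing_prob)
  also have "\<dots> \<le> log 2 ?K"
  proof -
    have correct: "sketch_correct ?M set_dis t S R"
      using sketch by (simp add: secure_sketch_def)
    have "1 \<le> real ?K * guessing_prob ?P"
      by (rule guessing_prob_ge_inverse_card; unfold supp)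
         (use M in \<open>auto intro!: card_le_max_code_size[OF assms(1,2)]
           sketch_value_candidates_far_apart[OF assms(1,4) correct] simp del: One_nat_def\<close>)
    then have "0 \<le> log 2 (real ?K * guessing_prob ?P)"
      by simp
    also have "\<dots> = log 2 ?K + log 2 (guessing_prob ?P)"
      using guessing_prob_pos[of ?P] max_code_size_pos[OF assms(3)]
      by (subst log_mult) auto
    finally show ?thesis by simp
  qed
  finally show ?thesis .
qed

section \<open>The permutation-based sketch and the final statement\<close>

lemma SDif_average_case_secure_sketch:
  assumes "finite U" and "card U = n" and "s \<le> n"
  shows "\<exists>S R. average_case_secure_sketch (SDif s U) set_dis m
    (m - log 2 (n choose s) + log 2 (max_code_size n (2 * t + 1) s)) t S R"
proof -
  obtain C where C: "C \<subseteq> SDif s U" "card C = max_code_size n (2 * t + 1) s"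
    and code: "\<And>x y. x \<in> C \<Longrightarrow> y \<in> C \<Longrightarrow> x \<noteq> y \<Longrightarrow> 2 * t + 1 \<le> set_dis x y"
    using max_code_size_attained[OF assms(1,2)] by metis
  \<comment> \<open>The points of the space are sets, so \<open>G\<close> consists of the image maps
    induced by the permutations rather than of the permutations themselves.\<close>
  define G where "G = (\<lambda>p. (`) p) ` {p. p permutes U}"
  have "C \<noteq> {}"
    using C(2) max_code_size_pos[OF assms(3), of "2 * t + 1"] by auto
  have "\<exists>S R. average_case_secure_sketch (SDif s U) set_dis m
    (m - log 2 (card (SDif s U)) + log 2 (card C)) t S R"
  proof (rule transitive_isometries_sketch[where G = G])
    show "finite G"
      by (simp add: G_def finite_permutations assms(1))
    show "finite (SDif s U)"
      by (simp add: finite_SDif assms(1))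
    fix g assume g: "g \<in> G"
    then obtain p where p: "p permutes U" "g = (`) p"
      by (auto simp: G_def)
    show "inj g"
      using p permutes_inj[OF p(1)] by (simp add: inj_image_eq_iff inj_def[of "(`) p"])
    show "g ` SDif s U \<subseteq> SDif s U"
      using p permutes_image_SDif by blast
    show "set_dis (g x) (g y) = set_dis x y" for x y
      using p by (simp add: set_dis_image permutes_inj)
    show "h \<circ> g \<in> G" if h: "h \<in> G" for h
    proof -
      obtain q where q: "q permutes U" "h = (`) q"
        using h by (auto simp: G_def)
      then have "h \<circ> g = (`) (q \<circ> p)"
        using p by (auto simp: image_comp)
      then show ?thesis
        using p q by (auto simp: G_def intro: permutes_compose)
    qed
  next
    show "\<exists>g\<in>G. g x = y" if "x \<in> SDif s U" "y \<in> SDif s U" for x y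
      using permutes_transitive_SDif[OF assms(1) that] by (auto simp: G_def)
    show "set_dis x y \<le> set_dis x z + set_dis y z"
      if "x \<in> SDif s U" "y \<in> SDif s U" "z \<in> SDif s U" for x y z
      using that assms(1) by (intro set_dis_triangle) (auto simp: SDif_def intro: finite_subset)
  qed (use C \<open>C \<noteq> {}\<close> code in auto)
  then show ?thesis
    using assms C by (simp add: card_SDif)
qed

theorem mainTheorem7:
  fixes U :: "'a set" and n s :: nat
  assumes "finite U" and "card U = n" and "1 \<le> s" and "s \<le> n"
  shows "(\<forall>(t::nat) (m::real). \<exists>SS Rec.
            average_case_secure_sketch (SDif s U) set_dis m
              (m - log 2 (real (n choose s)) + log 2 (real (max_code_size n (2 * t + 1) s)))
              t SS Rec)
       \<and> (\<forall>(t::nat) (m::real) (m'::real) SS Rec.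
            even t \<longrightarrow> m = log 2 (real (n choose s)) \<longrightarrow>
            secure_sketch (SDif s U) set_dis m m' t SS Rec \<longrightarrow>
            entropy_loss m m' \<ge>
              log 2 (real (n choose s)) - log 2 (real (max_code_size n (2 * t + 1) s)))"
proof (intro conjI allI impI)
  fix t m
  show "\<exists>SS Rec. average_case_secure_sketch (SDif s U) set_dis m
      (m - log 2 (real (n choose s)) + log 2 (real (max_code_size n (2 * t + 1) s))) t SS Rec"
    using SDif_average_case_secure_sketch[OF assms(1,2,4)] .
next
  fix t m m' SS Rec
  assume "even t" and m: "m = log 2 (real (n choose s))"
    and "secure_sketch (SDif s U) set_dis m m' t SS Rec"
  then have "m' \<le> log 2 (real (max_code_size n (2 * t + 1) s))"
    by (intro SDif_secure_sketch_bound[OF assms(1,2,4)]) auto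
  then show "entropy_loss m m' \<ge>
      log 2 (real (n choose s)) - log 2 (real (max_code_size n (2 * t + 1) s))"
    by (simp add: entropy_loss_def m)
qed

end
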